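(* If $A<\sum_{j=1}^J b_jQ_j$, then there exists a unique cycle length $T^*>0$ that minimizes the long-run average cost $T\mapsto C_F(T,\bm Q)$ over $T>0$. This optimal cycle length is characterized by the equation $$\sum_{j=1}^J b_jQ_jP(D_j(T^* )\ge Q_j+1)=A.$$
   Context: There are $J\ge1$ items. For each item $j$, $Q_j\ge1$ is an integer (slot capacity), $\lambda_j>0$ the demand rate, $b_j>0$ the unit shortage cost. $A>0$ is the fixed cost per replenishment, $\bm Q=(Q_1,\dots,Q_J)$. For $T>0$, $D_j(T)$ is a Poisson random variable with mean $\lambda_jT$, and the expected shortage of item $j$ in a cycle of length $T$ is $E[S_j(T,Q_j)]=\sum_{r=Q_j}^\infty(r-Q_j)P(D_j(T)=r)$. The long-run expected average cost per unit time of replenishing with fixed cycle length $T$ is $$C_F(T,\bm Q)=\frac{A+\sum_{j=1}^Jb_jE[S_j(T,Q_j)]}{T}.$$ *)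

theory Defs
  imports "HOL-Probability.Probability"
begin

text \<open>\<open>poisson_pmf\<close> is specified only for a positive rate, so this is used only for \<open>lam > 0\<close>
  and \<open>T > 0\<close>.\<close>

definition demand_pmf :: "real \<Rightarrow> real \<Rightarrow> nat pmf" where
  "demand_pmf lam T = poisson_pmf (lam * T)"

text \<open>The series below converges absolutely (the Poisson law has finite mean), so \<open>infsum\<close>
  does not fall back to its default value.\<close>

definition expected_shortage :: "real \<Rightarrow> real \<Rightarrow> nat \<Rightarrow> real" where
  "expected_shortage lam T q =
     (\<Sum>\<^sub>\<infinity>r\<in>{q..}. (real r - real q) * measure_pmf.prob (demand_pmf lam T) {r})"

text \<open>Only the values of \<open>lam\<close>, \<open>b\<close> and \<open>Q\<close> at the items \<open>1, \<dots>, J\<close> matter.\<close>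

definition avg_cost ::
  "nat \<Rightarrow> real \<Rightarrow> (nat \<Rightarrow> real) \<Rightarrow> (nat \<Rightarrow> real) \<Rightarrow> real \<Rightarrow> (nat \<Rightarrow> nat) \<Rightarrow> real" where
  "avg_cost J A lam b T Q = (A + (\<Sum>j=1..J. b j * expected_shortage (lam j) T (Q j))) / T"

definition optimal_cycle_length ::
  "nat \<Rightarrow> real \<Rightarrow> (nat \<Rightarrow> real) \<Rightarrow> (nat \<Rightarrow> real) \<Rightarrow> (nat \<Rightarrow> nat) \<Rightarrow> real \<Rightarrow> bool" where
  "optimal_cycle_length J A lam b Q T \<longleftrightarrow>
     T > 0 \<and> (\<forall>T'>0. avg_cost J A lam b T Q \<le> avg_cost J A lam b T' Q)"

end

theory Submission
  imports Defs
begin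

text \<open>With \<open>G\<^sub>n(x) = P(D \<ge> n)\<close> for a Poisson variable \<open>D\<close> of mean \<open>x\<close>, the expected shortage is
  \<open>x G\<^sub>q(x) - q G\<^sub>q\<^sub>+\<^sub>1(x)\<close>, and its derivative in \<open>x\<close> telescopes to \<open>G\<^sub>q(x)\<close>. Hence
  \<open>C\<^sub>F'(T) = (h(T) - A) / T\<^sup>2\<close> with \<open>h(T) = \<Sum>\<^sub>j b\<^sub>j Q\<^sub>j P(D\<^sub>j(T) \<ge> Q\<^sub>j + 1)\<close>. The function \<open>h\<close>
  increases strictly from \<open>0\<close> to \<open>\<Sum>\<^sub>j b\<^sub>j Q\<^sub>j > A\<close>, so the cost decreases strictly up to
  the unique root of \<open>h(T) = A\<close> and increases strictly after it.\<close>

text \<open>Subtracting a finite sum from 1 makes sense for every real \<open>x\<close>, in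
  particular at 0, where \<open>poisson_pmf\<close> is not specified, and can be differentiated term
  by term.\<close>

definition poisson_tail :: "nat \<Rightarrow> real \<Rightarrow> real" where
  "poisson_tail n x = 1 - (\<Sum>k<n. x ^ k / fact k * exp (-x))"

lemma prob_poisson_ge:
  assumes "x > 0"
  shows "measure_pmf.prob (poisson_pmf x) {r. r \<ge> n} = poisson_tail n x"
proof -
  have "measure_pmf.prob (poisson_pmf x) {r. r \<ge> n} = 1 - measure_pmf.prob (poisson_pmf x) {..<n}"
    using measure_pmf.prob_compl[of "{..<n}" "poisson_pmf x"]
    by (simp add: Compl_eq_Diff_UNIV[symmetric] not_less atLeast_def)
  also have "measure_pmf.prob (poisson_pmf x) {..<n} = (\<Sum>k<n. x ^ k / fact k * exp (-x))"
    using assms by (simp add: measure_measure_pmf_finite)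
  finally show ?thesis by (simp add: poisson_tail_def)
qed

lemma poisson_weights_sums: "(\<lambda>k. x ^ k / fact k * exp (-x)) sums (1::real)"
proof -
  have "(\<lambda>k. x ^ k / fact k) sums exp x"
    using exp_converges[of x] by (simp add: field_simps)
  from sums_mult2[OF this, of "exp (-x)"] show ?thesis
    by (simp flip: exp_add)
qed

text \<open>The size-bias identity of the Poisson law. It yields the full and the truncated mean,
  and later the cancellation in the derivative of the shortage.\<close>

lemma poisson_weight_Suc:
  "real (Suc k) * (x ^ Suc k / fact (Suc k) * exp (-x)) = x * (x ^ k / fact k * exp (-x))"
  by (simp add: field_simps del: of_nat_Suc)

lemma poisson_mean_sums: "(\<lambda>k. real k * (x ^ k / fact k * exp (-x))) sums x"
  using sums_Suc[of "\<lambda>k. real k * (x ^ k / fact k * exp (-x))" x]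
    sums_mult[OF poisson_weights_sums, of x x]
  unfolding poisson_weight_Suc by simp

lemma poisson_partial_mean:
  "(\<Sum>k<Suc q. real k * (x ^ k / fact k * exp (-x))) = x * (\<Sum>k<q. x ^ k / fact k * exp (-x))"
  unfolding sum.lessThan_Suc_shift poisson_weight_Suc by (simp add: sum_distrib_left)

lemma expected_shortage_eq:
  assumes "lam > 0" "T > 0"
  shows "expected_shortage lam T q =
    lam * T * poisson_tail q (lam * T) - real q * poisson_tail (Suc q) (lam * T)"
proof -
  define x where "x = lam * T"
  have x: "x > 0" using assms by (simp add: x_def)
  define p where "p k = x ^ k / fact k * exp (-x)" for k
  have p0: "p k \<ge> 0" for k using x by (simp add: p_def)
  define s where "s = x * poisson_tail q x - real q * poisson_tail (Suc q) x"
  \<comment> \<open>The cut is at \<open>Suc q\<close>: the term at \<open>q\<close> vanishes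
    anyway, and removing it produces \<open>poisson_tail (Suc q)\<close>, while the truncated mean,
    shifted by one, produces \<open>poisson_tail q\<close>.\<close>
  define f where "f k = (if k \<in> {..<Suc q} then 0 else (real k - real q) * p k)" for k
  have "(\<lambda>k. (real k - real q) * p k) sums (x - real q)"
    using sums_diff[OF poisson_mean_sums[of x] sums_mult[OF poisson_weights_sums[of x], of "real q"]]
    by (simp only: p_def left_diff_distrib mult_1_right)
  moreover have "s = x - real q + (\<Sum>k<Suc q. 0 - (real k - real q) * p k)"
  proof -
    have "(\<Sum>k<Suc q. 0 - (real k - real q) * p k)
        = real q * (\<Sum>k<Suc q. p k) - (\<Sum>k<Suc q. real k * p k)"
      unfolding sum_distrib_left sum_subtractf[symmetric]
      by (intro sum.cong) (auto simp: left_diff_distrib)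
    also have "(\<Sum>k<Suc q. real k * p k) = x * (\<Sum>k<q. p k)"
      unfolding p_def by (rule poisson_partial_mean)
    finally show ?thesis
      unfolding s_def poisson_tail_def p_def[symmetric] by (simp add: algebra_simps)
  qed
  ultimately have "f sums s"
    unfolding f_def by (intro sums_If_finite_set') auto
  \<comment> \<open>Nonnegativity turns the ordered series into the unconditional sum behind
    \<open>infsum\<close>.\<close>
  moreover have f0: "f k \<ge> 0" for k using p0[of k] by (auto simp: f_def)
  ultimately have "(f has_sum s) UNIV"
    by (intro sums_nonneg_imp_has_sum) auto
  moreover have "(f has_sum s) UNIV \<longleftrightarrow>
      ((\<lambda>r. (real r - real q) * measure_pmf.prob (demand_pmf lam T) {r}) has_sum s) {q..}"
    using x by (intro has_sum_cong_neutral)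
      (auto simp: f_def p_def demand_pmf_def x_def measure_pmf_single)
  ultimately show ?thesis
    unfolding expected_shortage_def s_def x_def by (auto intro: infsumI)
qed

text \<open>The weight at k > 0 has as derivative the weight at k - 1 minus the weight at k, so the
  sum telescopes. What remains is the Erlang density of the arrival number \<open>n + 1\<close> at
  unit rate.\<close>

lemma DERIV_poisson_tail_Suc:
  "(poisson_tail (Suc n) has_real_derivative x ^ n / fact n * exp (-x)) (at x)"
proof (induction n)
  case 0
  show ?case unfolding poisson_tail_def
    by (auto intro!: derivative_eq_intros)
next
  case (Suc n)
  have eq: "poisson_tail (Suc (Suc n)) =
      (\<lambda>x. poisson_tail (Suc n) x - x ^ Suc n / fact (Suc n) * exp (-x))"
    by (auto simp: poisson_tail_def)
  have "((\<lambda>x. x ^ Suc n / fact (Suc n)) has_real_derivative x ^ n / fact n) (at x)"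
    by (rule derivative_eq_intros refl | simp add: field_simps del: of_nat_Suc)+
  moreover have "((\<lambda>x. exp (-x)) has_real_derivative - exp (-x)) (at x)"
    by (auto intro!: derivative_eq_intros)
  ultimately have "(poisson_tail (Suc (Suc n)) has_real_derivative x ^ n / fact n * exp (-x)
      - (x ^ n / fact n * exp (-x) + - exp (-x) * (x ^ Suc n / fact (Suc n)))) (at x)"
    unfolding eq by (intro DERIV_diff Suc.IH DERIV_mult)
  then show ?case by (simp only: diff_add_eq_diff_diff_swap) (simp add: mult.commute)
qed

lemma poisson_tail_strict_mono:
  assumes "0 \<le> x" "x < y"
  shows "poisson_tail (Suc n) x < poisson_tail (Suc n) y"
\<comment> \<open>The derivative is required to be positive only inside the interval: for n > 0 it
  vanishes at 0, which is an allowed left endpoint.\<close>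
proof (rule DERIV_pos_imp_increasing_open[OF assms(2)])
  fix z assume "x < z" "z < y"
  then show "\<exists>d. DERIV (poisson_tail (Suc n)) z :> d \<and> d > 0"
    using assms DERIV_poisson_tail_Suc[of n z]
    by (intro exI[of _ "z ^ n / fact n * exp (-z)"]) auto
qed (intro continuous_at_imp_continuous_on ballI DERIV_isCont[OF DERIV_poisson_tail_Suc])

lemma poisson_tail_Suc_0: "poisson_tail (Suc n) 0 = 0"
  unfolding poisson_tail_def sum.lessThan_Suc_shift by simp

lemma poisson_tail_tendsto_1: "(poisson_tail n \<longlongrightarrow> 1) at_top"
proof -
  have "((\<lambda>x::real. x ^ k / fact k * exp (-x)) \<longlongrightarrow> 0) at_top" for k
    using tendsto_mult[OF tendsto_power_div_exp_0[of k] tendsto_const[of "1 / fact k"]]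
    by (simp add: exp_minus field_simps)
  then have "((\<lambda>x::real. 1 - (\<Sum>k<n. x ^ k / fact k * exp (-x))) \<longlongrightarrow> 1 - (\<Sum>k<n. 0)) at_top"
    by (intro tendsto_diff tendsto_const tendsto_sum)
  then show ?thesis by (simp add: poisson_tail_def[abs_def])
qed

text \<open>With \<open>q = Suc n\<close>, the product rule leaves x times the weight at n minus q
  times the weight at q, and these cancel by \<open>poisson_weight_Suc\<close>.\<close>

lemma DERIV_poisson_shortage:
  assumes "q \<ge> 1"
  shows "((\<lambda>x. x * poisson_tail q x - real q * poisson_tail (Suc q) x)
    has_real_derivative poisson_tail q x) (at x)"
proof -
  obtain n where q: "q = Suc n" using assms by (cases q) auto
  show ?thesis unfolding q
    using DERIV_diff[OF DERIV_mult[OF DERIV_ident DERIV_poisson_tail_Suc[of n x]]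
        DERIV_cmult[OF DERIV_poisson_tail_Suc[of "Suc n" x], of "real (Suc n)"]]
    unfolding poisson_weight_Suc by (simp add: mult.commute)
qed

text \<open>Each comparison stays on the interval between \<open>T\<close> and \<open>c\<close>,
  hence within the positive reals. At \<open>c\<close> itself the sign of \<open>F'\<close> is left
  open and continuity suffices.\<close>

lemma strict_min_if_deriv_sign_change:
  fixes F F' :: "real \<Rightarrow> real"
  assumes der: "\<And>t. t > 0 \<Longrightarrow> (F has_real_derivative F' t) (at t)"
    and neg: "\<And>t. 0 < t \<Longrightarrow> t < c \<Longrightarrow> F' t < 0"
    and pos: "\<And>t. c < t \<Longrightarrow> F' t > 0"
    and "c > 0" "T > 0" "T \<noteq> c"
  shows "F c < F T"
proof (cases "T < c")
  case True
  show ?thesis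
  proof (rule DERIV_neg_imp_decreasing_open[OF True])
    show "\<exists>y. DERIV F x :> y \<and> y < 0" if "T < x" "x < c" for x
      using that \<open>T > 0\<close> by (intro exI[of _ "F' x"]) (auto intro: der neg)
    show "continuous_on {T..c} F"
      using \<open>T > 0\<close> by (intro continuous_at_imp_continuous_on ballI DERIV_isCont[OF der]) auto
  qed
next
  case False
  with \<open>T \<noteq> c\<close> have "c < T" by simp
  then show ?thesis
  proof (rule DERIV_pos_imp_increasing_open)
    show "\<exists>y. DERIV F x :> y \<and> y > 0" if "c < x" "x < T" for x
      using that \<open>c > 0\<close> by (intro exI[of _ "F' x"]) (auto intro: der pos)
    show "continuous_on {c..T} F"
      using \<open>c > 0\<close> by (intro continuous_at_imp_continuous_on ballI DERIV_isCont[OF der]) auto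
  qed
qed

theorem theorem4:
  fixes J :: nat and A :: real and lam b :: "nat \<Rightarrow> real" and Q :: "nat \<Rightarrow> nat"
  assumes "J \<ge> 1"
    and "A > 0"
    and "\<And>j. j \<in> {1..J} \<Longrightarrow> lam j > 0"
    and "\<And>j. j \<in> {1..J} \<Longrightarrow> b j > 0"
    and "\<And>j. j \<in> {1..J} \<Longrightarrow> Q j \<ge> 1"
    and "A < (\<Sum>j=1..J. b j * real (Q j))"
  shows "(\<exists>!T. optimal_cycle_length J A lam b Q T) \<and>
    (\<forall>T>0. optimal_cycle_length J A lam b Q T \<longleftrightarrow>
      (\<Sum>j=1..J. b j * real (Q j) *
         measure_pmf.prob (demand_pmf (lam j) T) {r. r \<ge> Q j + 1}) = A)"
proof -
  note lam = assms(3) and b = assms(4) and Q = assms(5)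
  define h where "h T = (\<Sum>j=1..J. b j * real (Q j) * poisson_tail (Suc (Q j)) (lam j * T))" for T
  define S where "S j x = x * poisson_tail (Q j) x - real (Q j) * poisson_tail (Suc (Q j)) x" for j x
  define F where "F T = (A + (\<Sum>j=1..J. b j * S j (lam j * T))) / T" for T
  have prob_eq: "(\<Sum>j=1..J. b j * real (Q j) *
      measure_pmf.prob (demand_pmf (lam j) T) {r. r \<ge> Q j + 1}) = h T" if "T > 0" for T
    unfolding h_def demand_pmf_def using that lam
    by (intro sum.cong refl) (simp add: prob_poisson_ge)
  have cost_eq: "avg_cost J A lam b T Q = F T" if "T > 0" for T
    unfolding avg_cost_def F_def S_def using that lam
    by (intro arg_cong2[of _ _ _ _ "(/)"] arg_cong2[of _ _ _ _ "(+)"] sum.cong refl)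
      (simp add: expected_shortage_eq)
  have derF: "(F has_real_derivative (h T - A) / T\<^sup>2) (at T)" if "T > 0" for T
  proof -
    have "((\<lambda>T. S j (lam j * T)) has_real_derivative poisson_tail (Q j) (lam j * T) * lam j) (at T)"
      if "j \<in> {1..J}" for j
      unfolding S_def by (rule DERIV_chain2[OF DERIV_poisson_shortage[OF Q[OF that]]])
        (auto intro!: derivative_eq_intros)
    then have "((\<lambda>T. A + (\<Sum>j=1..J. b j * S j (lam j * T))) has_real_derivative
        (\<Sum>j=1..J. b j * (poisson_tail (Q j) (lam j * T) * lam j))) (at T)"
      (is "(_ has_real_derivative ?D) _")
      by (auto intro!: DERIV_cmult DERIV_cong[OF DERIV_add[OF DERIV_const DERIV_sum]])
    from DERIV_divide[OF this DERIV_ident] that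
    have "(F has_real_derivative
        (?D * T - (A + (\<Sum>j=1..J. b j * S j (lam j * T)))) / T\<^sup>2) (at T)"
      unfolding F_def[abs_def] by (simp add: power2_eq_square)
    \<comment> \<open>Since the argument of \<open>S j\<close> is \<open>lam j * T\<close>, its
      first summand cancels against \<open>T\<close> times its derivative, and only the tails at
      \<open>Suc (Q j)\<close> survive.\<close>
    moreover have "?D * T - (\<Sum>j=1..J. b j * S j (lam j * T)) = h T"
      unfolding h_def S_def sum_distrib_right sum_subtractf[symmetric]
      by (intro sum.cong refl) (simp add: algebra_simps)
    ultimately show ?thesis by (simp add: diff_diff_eq2 algebra_simps)
  qed
  \<comment> \<open>Each summand is strictly increasing, and \<open>J \<ge> 1\<close> makes the sum
    nonempty. The case \<open>x = 0\<close> is included.\<close>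
  have h_mono: "h x < h y" if "0 \<le> x" "x < y" for x y
    unfolding h_def using assms(1) that
    by (intro sum_strict_mono mult_strict_left_mono poisson_tail_strict_mono
        mult_nonneg_nonneg mult_pos_pos)
      (use lam b Q in \<open>auto simp: less_imp_le Suc_le_eq\<close>)
  have h_0: "h 0 = 0" by (simp add: h_def poisson_tail_Suc_0)
  have "(h \<longlongrightarrow> (\<Sum>j=1..J. b j * real (Q j) * 1)) at_top"
    unfolding h_def[abs_def]
    by (intro tendsto_intros filterlim_compose[OF poisson_tail_tendsto_1]
        filterlim_tendsto_pos_mult_at_top[OF tendsto_const] filterlim_ident lam)
  \<comment> \<open>The limit of \<open>h\<close> exceeds \<open>A\<close> by the last hypothesis,
    so some \<open>B\<close> lies beyond the level \<open>A\<close>; together with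
    \<open>h 0 = 0\<close> this brackets a root.\<close>
  then have "eventually (\<lambda>T. A < h T \<and> T \<ge> 0) at_top"
    using assms(6) by (intro eventually_conj order_tendstoD(1)[of h] eventually_ge_at_top) auto
  then obtain B where B: "A < h B" "B \<ge> 0"
    by (auto dest: eventually_happens)
  have "continuous_on {0..B} h"
    unfolding h_def[abs_def]
    by (intro continuous_intros continuous_at_imp_continuous_on ballI
        continuous_within_compose3[OF DERIV_isCont[OF DERIV_poisson_tail_Suc]])
  then obtain c where c: "h c = A" "0 \<le> c"
    using IVT'[of h 0 A B] B h_0 assms(2) by auto
  with h_0 assms(2) have "c > 0" by (cases "c = 0") auto
  have min: "F c < F T" if "T > 0" "T \<noteq> c" for T
  proof (rule strict_min_if_deriv_sign_change[OF derF])
    show "(h t - A) / t\<^sup>2 < 0" if "0 < t" "t < c" for t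
      using h_mono[of t c] that c by (simp add: divide_neg_pos)
    show "(h t - A) / t\<^sup>2 > 0" if "c < t" for t
      using h_mono[of c t] that c by simp
  qed (use that \<open>c > 0\<close> in auto)
  \<comment> \<open>Strictness in \<open>min\<close> rules out any second minimizer.\<close>
  have opt: "optimal_cycle_length J A lam b Q T \<longleftrightarrow> T = c" for T
    unfolding optimal_cycle_length_def using min \<open>c > 0\<close>
    by (metis cost_eq less_eq_real_def not_less)
  have root: "h T = A \<longleftrightarrow> T = c" if "T > 0" for T
    using h_mono[of T c] h_mono[of c T] that \<open>c > 0\<close> c(1) by (cases T c rule: linorder_cases) auto
  \<comment> \<open>For \<open>T > 0\<close>, optimality and the equation both reduce to
    \<open>T = c\<close>.\<close>
  show ?thesis
    by (intro conjI ex1I[of _ c] allI impI) (simp_all only: opt prob_eq root)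
qed

end
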